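(* For each integer $n\ge 0$, the tagged partitions of $\{1,\ldots,n\}$ are in one-to-one correspondence with the $B$-type partitions of $\{-n,\ldots,n\}$. Thus the number of polydiagonal subspaces of $\mathbb{R}^n$ is the $n$-th Dowling number.
   Context: A partial involution on a set $X$ is a map $x\mapsto x^*:\tilde X\to\tilde X$ defined on a (possibly empty) subset $\tilde X\subseteq X$ that is its own inverse. A tagged partition of a finite set $C$ is a partition $\mathcal{P}$ of $C$ (into nonempty classes) together with a partial involution $P\mapsto P^*$ on $\mathcal{P}$ that has at most one fixed point. The class of $i$ is denoted by $[i]$. For a tagged partition $\mathcal{P}$ of $\{1,\ldots,n\}$, the polydiagonal subspace is $$\Delta_{\mathcal{P}}=\{x\in\mathbb{R}^n\mid x_i=x_j\text{ if }[i]=[j],\text{ and }x_i=-x_j\text{ if }[i]^*=[j]\};$$ a subspace of $\mathbb{R}^n$ is a polydiagonal subspace if it equals $\Delta_{\mathcal P}$ for some tagged partition $\mathcal{P}$ of $\{1,\ldots,n\}$. The map $\mathcal{P}\mapsto\Delta_{\mathcal{P}}$ is a bijection from tagged partitions to polydiagonal subspaces. A $B$-type partition of $\{-n,\ldots,n\}$ is a partition $\mathcal{Q}$ of this set such that (1) if $Q=\{j_1,\ldots,j_k\}$ is a class in $\mathcal{Q}$, then so is $-Q:=\{-j_1,\ldots,-j_k\}$; and (2) there is precisely one class $Q_0\in\mathcal{Q}$ for which $Q_0=-Q_0$. The Dowling numbers (OEIS A007405: $1,2,6,24,116,648,\ldots$) are the sequence $(D_n)_{n\ge0}$ with exponential generating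 function $\sum_{n\ge0}D_n\frac{x^n}{n!}=e^{x+(e^{2x}-1)/2}$; it is known that $D_n$ is the number of $B$-type partitions of $\{-n,\ldots,n\}$. *)

theory Defs
  imports
    "HOL-Library.Disjoint_Sets"
    "HOL-Library.FuncSet"
    "HOL-Computational_Algebra.Formal_Power_Series"
begin

text \<open>A partially defined self-map of \<open>X\<close> is a map of type \<open>'a \<rightharpoonup> 'a\<close> that is \<open>None\<close> outside
  its domain, so that distinct partial involutions are distinct values. The symmetry condition
  says both that the image lies in the domain and that the map is its own inverse.\<close>

definition partial_involution_on :: "'a set \<Rightarrow> ('a \<rightharpoonup> 'a) \<Rightarrow> bool" where
  "partial_involution_on X s \<longleftrightarrow> dom s \<subseteq> X \<and> (\<forall>a b. s a = Some b \<longrightarrow> s b = Some a)"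

definition tagged_partition_on :: "'a set \<Rightarrow> 'a set set \<times> ('a set \<rightharpoonup> 'a set) \<Rightarrow> bool" where
  "tagged_partition_on C = (\<lambda>(P, s). partition_on C P \<and> partial_involution_on P s \<and>
     (\<forall>A B. s A = Some A \<and> s B = Some B \<longrightarrow> A = B))"

definition class_of :: "'a set set \<Rightarrow> 'a \<Rightarrow> 'a set" where
  "class_of P i = (THE A. A \<in> P \<and> i \<in> A)"

text \<open>\<open>\<real>\<^sup>n\<close> is the set of extensional functions \<open>{1..n} \<rightarrow>\<^sub>E UNIV\<close>; this allows \<open>n\<close> to vary and
  includes \<open>n = 0\<close>, where it consists of a single point.\<close>

definition polydiagonal :: "nat \<Rightarrow> nat set set \<times> (nat set \<rightharpoonup> nat set) \<Rightarrow> (nat \<Rightarrow> real) set" where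
  "polydiagonal n = (\<lambda>(P, s). {x \<in> {1..n} \<rightarrow>\<^sub>E UNIV. \<forall>i\<in>{1..n}. \<forall>j\<in>{1..n}.
     (class_of P i = class_of P j \<longrightarrow> x i = x j) \<and>
     (s (class_of P i) = Some (class_of P j) \<longrightarrow> x i = - x j)})"

definition is_polydiagonal_subspace :: "nat \<Rightarrow> (nat \<Rightarrow> real) set \<Rightarrow> bool" where
  "is_polydiagonal_subspace n V \<longleftrightarrow> (\<exists>T. tagged_partition_on {1..n} T \<and> V = polydiagonal n T)"

definition B_type_partition :: "nat \<Rightarrow> int set set \<Rightarrow> bool" where
  "B_type_partition n \<Q> \<longleftrightarrow> partition_on {- int n..int n} \<Q> \<and>
     (\<forall>Q\<in>\<Q>. uminus ` Q \<in> \<Q>) \<and> (\<exists>!Q. Q \<in> \<Q> \<and> Q = uminus ` Q)"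

text \<open>The exponential generating function \<open>e^(x + (e^(2x) - 1) / 2)\<close>. The inner series has zero
  constant term, so the formal composition is meaningful.\<close>

definition dowling_egf :: "real fps" where
  "dowling_egf = fps_exp 1 oo (fps_X + fps_const (1 / 2) * (fps_exp 2 - 1))"

definition dowling :: "nat \<Rightarrow> real" where
  "dowling n = fact n * fps_nth dowling_egf n"

lemma dowling_egf_eq: "Abs_fps (\<lambda>n. dowling n / fact n) = dowling_egf"
  by (rule fps_ext) (simp add: dowling_def)

end

theory Submission
  imports Defs
begin

text \<open>Tagged partitions of \<open>{1..n}\<close> and B-type partitions of \<open>{-n..n}\<close> are both sign-compatible
  equivalence relations on the signed indices, and such a relation is determined by the odd map
  sending every index to the element of least absolute value in its class (to \<open>0\<close> for the class
  that is its own negative). These maps are the odd, idempotent \<open>f\<close> on \<open>{-n..n}\<close>, extended by \<open>0\<close>, with \<open>\<bar>f i\<bar> \<le> \<bar>i\<bar>\<close>. To extend such a map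
  from \<open>n\<close> to \<open>n + 1\<close>, the new index is sent either to one of the \<open>c\<close> fixed points or to itself,
  which creates two new fixed points. The resulting recurrence \<open>W (k + 1) c = c W k c + W k (c + 2)\<close> is
  solved by the generating functions \<open>F(x) e^((c - 1) x)\<close>, where \<open>F' = (1 + e^(2 x)) F\<close> is the one of
  the Dowling numbers.\<close>

section \<open>Odd retractions as normal forms of signed equivalence relations\<close>

definition odd_retractions :: "nat \<Rightarrow> (int \<Rightarrow> int) set" where
  "odd_retractions n = {f. (\<forall>i. f (- i) = - f i) \<and> (\<forall>i. f (f i) = f i) \<and>
     (\<forall>i. \<bar>f i\<bar> \<le> \<bar>i\<bar>) \<and> (\<forall>i. \<bar>i\<bar> > int n \<longrightarrow> f i = 0)}"

lemma odd_retractionsD: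
  assumes "f \<in> odd_retractions n"
  shows "f (- i) = - f i" "f (f i) = f i" "\<bar>f i\<bar> \<le> \<bar>i\<bar>" "\<bar>i\<bar> > int n \<Longrightarrow> f i = 0" "f 0 = 0"
proof -
  show "f (- i) = - f i" "f (f i) = f i" "\<bar>f i\<bar> \<le> \<bar>i\<bar>" "\<bar>i\<bar> > int n \<Longrightarrow> f i = 0"
    using assms by (auto simp: odd_retractions_def)
  have "\<bar>f 0\<bar> \<le> \<bar>0\<bar>" using assms unfolding odd_retractions_def by blast
  then show "f 0 = 0" by simp
qed

lemma odd_retraction_abs_le:
  assumes "f \<in> odd_retractions n"
  shows "\<bar>f i\<bar> \<le> int n"
proof (cases "\<bar>i\<bar> > int n")
  case True
  then show ?thesis using odd_retractionsD(4)[OF assms] by simp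
next
  case False
  then show ?thesis using odd_retractionsD(3)[OF assms, of i] by linarith
qed

text \<open>Idempotence and equal kernels give \<open>g (f i) = g i\<close> and
  \<open>f (g i) = f i\<close>, so \<open>f i\<close> and \<open>g i\<close> bound each other in
  absolute value and differ at most by sign. If \<open>f i = - g i\<close>, oddness gives
  \<open>g i = g (- g i) = - g i\<close>, hence both are 0.\<close>

lemma odd_retraction_eqI:
  assumes f: "f \<in> odd_retractions n" and g: "g \<in> odd_retractions m"
    and kernel: "\<And>i j. f i = f j \<longleftrightarrow> g i = g j"
  shows "f = g"
proof
  fix i
  note F = odd_retractionsD[OF f] and G = odd_retractionsD[OF g]
  have gf: "g (f i) = g i" and fg: "f (g i) = f i"
    using kernel F(2) G(2) by blast+
  have "\<bar>f i\<bar> = \<bar>g i\<bar>"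
    using F(3)[of "g i"] G(3)[of "f i"] gf fg by linarith
  moreover have "g i = 0" if "f i = - g i"
    using gf G(1)[of "g i"] G(2)[of i] that by simp
  ultimately show "f i = g i" by linarith
qed

text \<open>Each signed equivalence class other than that of \<open>0\<close> contains exactly one element of least
  absolute value, and \<open>f\<close> sends the class to it.\<close>

lemma ex_odd_retraction:
  fixes h :: "int \<Rightarrow> 'a"
  assumes neg: "\<And>i j. h i = h j \<Longrightarrow> h (- i) = h (- j)"
    and self: "\<And>i. h (- i) = h i \<Longrightarrow> h i = h 0"
    and outside: "\<And>i. \<bar>i\<bar> > int n \<Longrightarrow> h i = h 0"
  shows "\<exists>f\<in>odd_retractions n. \<forall>i j. f i = f j \<longleftrightarrow> h i = h j"
proof -
  define L where "L i j \<longleftrightarrow> h j = h i \<and> (\<forall>k. h k = h i \<longrightarrow> \<bar>j\<bar> \<le> \<bar>k\<bar>)" for i j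
  define f where "f i = (SOME j. L i j)" for i
  have ex: "\<exists>j. L i j" for i
  proof -
    obtain j where "h j = h i" "\<And>k. h k = h i \<Longrightarrow> nat \<bar>j\<bar> \<le> nat \<bar>k\<bar>"
      using ex_has_least_nat[of "\<lambda>j. h j = h i" i "\<lambda>j. nat \<bar>j\<bar>"] by blast
    then show ?thesis unfolding L_def by (metis abs_ge_zero nat_le_eq_zle)
  qed
  have Lf: "L i (f i)" for i
    unfolding f_def by (rule someI_ex[OF ex])
  \<comment> \<open>Two distinct minimisers of one class must be \<open>j\<close> and
    \<open>- j\<close>. By \<open>self\<close> they then share the class of 0, whose least absolute
    value is 0, so they coincide after all.\<close>
  have uniq: "j = k" if j: "L i j" and k: "L i k" for i j k
  proof (rule ccontr)
    assume "j \<noteq> k"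
    have "\<bar>j\<bar> = \<bar>k\<bar>" using j k unfolding L_def by (metis order_antisym)
    with \<open>j \<noteq> k\<close> have "k = - j" by linarith
    then have "h (- j) = h j" using j k by (simp add: L_def)
    then have "h 0 = h i" using self[of j] j by (simp add: L_def)
    then have "\<bar>j\<bar> \<le> \<bar>0\<bar>" using j unfolding L_def by blast
    with \<open>k = - j\<close> \<open>j \<noteq> k\<close> show False by simp
  qed
  have fI: "f i = j" if "L i j" for i j using uniq[OF Lf that] .
  have hf: "h (f i) = h i" for i using Lf by (simp add: L_def)
  have cong: "f i = f j" if "h i = h j" for i j
    using Lf[of j] that by (intro fI) (simp add: L_def)
  have negL: "L (- i) (- j)" if "L i j" for i j
    using that neg unfolding L_def by (metis abs_minus_cancel minus_minus)
  have f0: "f 0 = 0" by (rule fI) (simp add: L_def)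
  have "f \<in> odd_retractions n"
    unfolding odd_retractions_def
  proof (intro CollectI conjI allI impI)
    show "f (- i) = - f i" for i by (intro fI negL Lf)
    show "f (f i) = f i" for i by (intro cong hf)
    show "\<bar>f i\<bar> \<le> \<bar>i\<bar>" for i using Lf[of i] by (simp add: L_def)
    show "f i = 0" if "\<bar>i\<bar> > int n" for i using cong[OF outside[OF that]] f0 by simp
  qed
  moreover have "f i = f j \<longleftrightarrow> h i = h j" for i j
    using cong hf by metis
  ultimately show ?thesis by blast
qed

subsection \<open>Counting odd retractions\<close>

text \<open>The number of ways to extend an odd retraction with \<open>c\<close> fixed points by \<open>k\<close> further indices.\<close>

definition dowling_shift :: "nat \<Rightarrow> nat \<Rightarrow> real" where
  "dowling_shift k c = fact k * fps_nth (dowling_egf * fps_exp (real c - 1)) k"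

lemma dowling_egf_deriv: "fps_deriv dowling_egf = dowling_egf * (1 + fps_exp 2)"
proof -
  let ?g = "fps_X + fps_const (1 / 2) * (fps_exp 2 - 1) :: real fps"
  have "fps_deriv (fps_exp 1 oo ?g) = (fps_deriv (fps_exp 1) oo ?g) * fps_deriv ?g"
    by (rule fps_compose_deriv) simp
  moreover have "fps_deriv ?g = 1 + fps_exp 2"
    by (simp flip: mult.assoc)
  ultimately show ?thesis by (simp add: dowling_egf_def)
qed

lemma dowling_shift_0: "dowling_shift 0 c = 1"
  by (simp add: dowling_shift_def dowling_egf_def fps_compose_nth)

lemma dowling_shift_1: "dowling_shift k 1 = dowling k"
  by (simp add: dowling_shift_def dowling_def)

text \<open>Differentiating \<open>F e^(a x)\<close> with \<open>F' = (1 + e^(2 x)) F\<close> gives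
  \<open>(1 + a) F e^(a x) + F e^((a + 2) x)\<close>. The coefficient \<open>1 + a\<close> has to be
  \<open>c\<close>, which explains the exponent \<open>c - 1\<close>.\<close>

lemma dowling_shift_Suc:
  "dowling_shift (Suc k) c = real c * dowling_shift k c + dowling_shift k (c + 2)"
proof -
  let ?a = "real c - 1"
  have e: "fps_exp (?a + 2) = fps_exp ?a * fps_exp (2::real)"
    by (rule fps_exp_add_mult)
  have "fps_deriv (dowling_egf * fps_exp ?a) =
      dowling_egf * fps_exp ?a + fps_const ?a * (dowling_egf * fps_exp ?a)
      + dowling_egf * fps_exp (?a + 2)"
    unfolding e by (simp add: dowling_egf_deriv algebra_simps)
  from arg_cong[OF this, where f = "\<lambda>F. fps_nth F k"]
  have "fps_nth (fps_deriv (dowling_egf * fps_exp ?a)) k =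
      real c * fps_nth (dowling_egf * fps_exp ?a) k + fps_nth (dowling_egf * fps_exp (?a + 2)) k"
    by (simp only: fps_add_nth fps_mult_left_const_nth left_diff_distrib mult_1)
  moreover have "fact (Suc k) * fps_nth F (Suc k) = fact k * fps_nth (fps_deriv F) k" for F :: "real fps"
    by (simp add: fps_deriv_nth)
  moreover have "real (c + 2) - 1 = ?a + 2" by simp
  ultimately show ?thesis
    unfolding dowling_shift_def by (simp only: distrib_left mult.left_commute)
qed

section \<open>Adding one index to an odd retraction\<close>

definition fixed_points :: "('a \<Rightarrow> 'a) \<Rightarrow> 'a set" where
  "fixed_points f = {x. f x = x}"

text \<open>Oddness forces the value at \<open>- m\<close>, so \<open>v\<close> is the only freedom
  in an extension. Taking \<open>v = 0\<close> removes the index \<open>m\<close> again.\<close>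

definition odd_update :: "int \<Rightarrow> (int \<Rightarrow> int) \<Rightarrow> int \<Rightarrow> int \<Rightarrow> int" where
  "odd_update m f v = f(m := v, - m := - v)"

lemma fixed_points_subset:
  assumes "f \<in> odd_retractions n"
  shows "fixed_points f \<subseteq> {- int n..int n}"
proof
  fix i assume "i \<in> fixed_points f"
  then show "i \<in> {- int n..int n}"
    using odd_retraction_abs_le[OF assms, of i] by (auto simp: fixed_points_def)
qed

lemma finite_fixed_points: "f \<in> odd_retractions n \<Longrightarrow> finite (fixed_points f)"
  using fixed_points_subset finite_subset by blast

lemma odd_retractions_0: "odd_retractions 0 = {\<lambda>_. 0}"
proof -
  have "f i = 0" if "f \<in> odd_retractions 0" for f i
    using odd_retraction_abs_le[OF that, of i] by simp
  then show ?thesis by (auto simp: odd_retractions_def)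
qed

lemma odd_update_in_odd_retractions:
  assumes f: "f \<in> odd_retractions n" and v: "v \<in> insert (int n + 1) (fixed_points f)"
  shows "odd_update (int n + 1) f v \<in> odd_retractions (Suc n)"
proof -
  note F = odd_retractionsD[OF f]
  have v': "v = int n + 1 \<or> f v = v \<and> \<bar>v\<bar> \<le> int n"
    using v odd_retraction_abs_le[OF f, of v] by (auto simp: fixed_points_def)
  \<comment> \<open>The old map never takes the two new values, so away from the new indices
    idempotence is inherited.\<close>
  have ne: "f i \<noteq> int n + 1" "f i \<noteq> - int n - 1" for i
    using odd_retraction_abs_le[OF f, of i] by auto
  show ?thesis
    unfolding odd_retractions_def
  proof (intro CollectI conjI allI impI)
    let ?g = "odd_update (int n + 1) f v"
    show "?g (- i) = - ?g i" for i
      by (auto simp: odd_update_def F)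
    show "?g (?g i) = ?g i" for i
      using v' ne by (auto simp: odd_update_def F)
    show "\<bar>?g i\<bar> \<le> \<bar>i\<bar>" for i
      using v' by (auto simp: odd_update_def F)
    show "?g i = 0" if "\<bar>i\<bar> > int (Suc n)" for i
      using that by (auto simp: odd_update_def intro: F)
  qed
qed

text \<open>The inverse records the value at the last index and then resets both signs of that index
  to 0.\<close>

lemma bij_betw_odd_update:
  "bij_betw (\<lambda>(f, v). odd_update (int n + 1) f v)
     (SIGMA f:odd_retractions n. insert (int n + 1) (fixed_points f)) (odd_retractions (Suc n))"
proof (rule bij_betw_byWitness[where f' = "\<lambda>g. (odd_update (int n + 1) g 0, g (int n + 1))"])
  let ?m = "int n + 1"
  let ?S = "SIGMA f:odd_retractions n. insert ?m (fixed_points f)"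
  show "\<forall>p\<in>?S. (\<lambda>g. (odd_update ?m g 0, g ?m)) ((\<lambda>(f, v). odd_update ?m f v) p) = p"
  proof
    fix p assume "p \<in> ?S"
    then obtain f v where p: "p = (f, v)" and f: "f \<in> odd_retractions n" by blast
    have "f ?m = 0" "f (- ?m) = 0" by (rule odd_retractionsD[OF f]; simp)+
    then show "(\<lambda>g. (odd_update ?m g 0, g ?m)) ((\<lambda>(f, v). odd_update ?m f v) p) = p"
      unfolding p by (auto simp: odd_update_def fun_eq_iff)
  qed
  show "\<forall>g\<in>odd_retractions (Suc n). (\<lambda>(f, v). odd_update ?m f v) (odd_update ?m g 0, g ?m) = g"
    by (auto simp: odd_update_def fun_eq_iff dest: odd_retractionsD(1)[where i = ?m])
  show "(\<lambda>(f, v). odd_update ?m f v) ` ?S \<subseteq> odd_retractions (Suc n)"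
    using odd_update_in_odd_retractions by auto
  show "(\<lambda>g. (odd_update ?m g 0, g ?m)) ` odd_retractions (Suc n) \<subseteq> ?S"
  proof (rule image_subsetI)
    fix g assume g: "g \<in> odd_retractions (Suc n)"
    note G = odd_retractionsD[OF g]
    let ?f = "odd_update ?m g 0"
    \<comment> \<open>Otherwise oddness would give \<open>g (g ?m) = g (- ?m) = ?m\<close>, against
      idempotence. So \<open>g ?m\<close> is \<open>?m\<close> itself or a fixed point that survives
      the reset.\<close>
    have gm: "g ?m \<noteq> - ?m" using G(1)[of ?m] G(2)[of ?m] by auto
    \<comment> \<open>Indices up to \<open>n\<close> have values of absolute value at most
      \<open>n\<close>, and those beyond \<open>n + 1\<close> have value 0, so the reset does not
      disturb idempotence.\<close>
    have ne: "g i \<noteq> ?m \<and> g i \<noteq> - ?m" if "i \<noteq> ?m" "i \<noteq> - ?m" for i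
    proof -
      have "\<bar>i\<bar> \<le> int n \<or> \<bar>i\<bar> > int (Suc n)" using that by arith
      then show ?thesis using G(3)[of i] G(4)[of i] by auto
    qed
    have "?f \<in> odd_retractions n"
      unfolding odd_retractions_def
    proof (intro CollectI conjI allI impI)
      show "?f (- i) = - ?f i" for i by (auto simp: odd_update_def G)
      show "?f (?f i) = ?f i" for i
        using ne[of i] by (auto simp: odd_update_def G)
      show "\<bar>?f i\<bar> \<le> \<bar>i\<bar>" for i by (auto simp: odd_update_def G)
      show "?f i = 0" if "\<bar>i\<bar> > int n" for i
        using that G(4)[of i] by (auto simp: odd_update_def)
    qed
    moreover have "g ?m \<in> insert ?m (fixed_points ?f)"
      using gm G(2)[of ?m] by (auto simp: fixed_points_def odd_update_def)
    ultimately show "(?f, g ?m) \<in> ?S" by simp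
  qed
qed

text \<open>The two new indices are fixed neither before, where their value is 0, nor after, where
  it is at most \<open>n\<close> in absolute value.\<close>

lemma fixed_points_odd_update:
  assumes f: "f \<in> odd_retractions n" and v: "v \<in> fixed_points f"
  shows "fixed_points (odd_update (int n + 1) f v) = fixed_points f"
proof -
  have "v \<in> {- int n..int n}" using fixed_points_subset[OF f] v by blast
  moreover have "f (int n + 1) = 0" "f (- int n - 1) = 0"
    by (rule odd_retractionsD(4)[OF f]; simp)+
  ultimately show ?thesis by (auto simp: fixed_points_def odd_update_def)
qed

lemma card_fixed_points_odd_update_new:
  assumes f: "f \<in> odd_retractions n"
  shows "card (fixed_points (odd_update (int n + 1) f (int n + 1))) = card (fixed_points f) + 2"
proof -
  let ?m = "int n + 1"
  have "?m \<notin> fixed_points f" "- ?m \<notin> fixed_points f" using fixed_points_subset[OF f] by auto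
  moreover have "fixed_points (odd_update ?m f ?m) = insert ?m (insert (- ?m) (fixed_points f))"
    by (auto simp: fixed_points_def odd_update_def)
  ultimately show ?thesis using finite_fixed_points[OF f] by simp
qed

lemma finite_odd_retractions: "finite (odd_retractions n)"
proof (induction n)
  case 0
  show ?case by (simp add: odd_retractions_0)
next
  case (Suc n)
  then show ?case
    using bij_betw_finite[OF bij_betw_odd_update[of n]] finite_fixed_points by blast
qed

text \<open>Induction on \<open>n\<close> with \<open>k\<close> free: one index moves from those
  still to be added to those already placed, and \<open>n + k\<close> stays constant. At
  \<open>n = 0\<close> only the zero map remains, with its single fixed point 0.\<close>

lemma sum_dowling_shift:
  "(\<Sum>f\<in>odd_retractions n. dowling_shift k (card (fixed_points f))) = dowling_shift (n + k) 1"
proof (induction n arbitrary: k)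
  case 0
  have "fixed_points (\<lambda>_. 0 :: int) = {0}" by (auto simp: fixed_points_def)
  then show ?case by (simp add: odd_retractions_0)
next
  case (Suc n)
  let ?m = "int n + 1"
  let ?w = "\<lambda>k f. dowling_shift k (card (fixed_points f))"
  have "sum (?w k) (odd_retractions (Suc n)) =
      (\<Sum>(f, v)\<in>(SIGMA f:odd_retractions n. insert ?m (fixed_points f)). ?w k (odd_update ?m f v))"
    by (subst sum.reindex_bij_betw[OF bij_betw_odd_update, symmetric])
      (simp add: case_prod_unfold)
  also have "\<dots> = (\<Sum>f\<in>odd_retractions n. \<Sum>v\<in>insert ?m (fixed_points f). ?w k (odd_update ?m f v))"
    by (rule sum.Sigma[symmetric]) (auto simp: finite_odd_retractions finite_fixed_points)
  \<comment> \<open>For \<open>c\<close> fixed points there are \<open>c\<close> extensions keeping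
    that number and one raising it to \<open>c + 2\<close>; this is the right-hand side of
    \<open>dowling_shift_Suc\<close>.\<close>
  also have "\<dots> = sum (?w (Suc k)) (odd_retractions n)"
  proof (rule sum.cong[OF refl])
    fix f assume f: "f \<in> odd_retractions n"
    have "?m \<notin> fixed_points f" using fixed_points_subset[OF f] by auto
    then show "(\<Sum>v\<in>insert ?m (fixed_points f). ?w k (odd_update ?m f v)) = ?w (Suc k) f"
      by (simp add: finite_fixed_points[OF f] card_fixed_points_odd_update_new[OF f]
          fixed_points_odd_update[OF f] dowling_shift_Suc)
  qed
  also have "\<dots> = dowling_shift (Suc n + k) 1" using Suc.IH[of "Suc k"] by simp
  finally show ?case .
qed

text \<open>For \<open>k = 0\<close> every weight is 1, so the sum counts the maps.\<close>

lemma card_odd_retractions: "real (card (odd_retractions n)) = dowling n"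
  using sum_dowling_shift[of 0 n] by (simp add: dowling_shift_0 dowling_shift_1[simplified])

subsection \<open>Classes of a partition\<close>

lemma class_of_eqI: "partition_on C P \<Longrightarrow> A \<in> P \<Longrightarrow> i \<in> A \<Longrightarrow> class_of P i = A"
  unfolding class_of_def by (rule the_equality) (auto dest: partition_onD2 disjointD)

lemma class_of_in:
  assumes "partition_on C P" "i \<in> C"
  shows "class_of P i \<in> P" "i \<in> class_of P i"
proof -
  obtain A where "A \<in> P" "i \<in> A" using assms by (auto simp: partition_on_def)
  then show "class_of P i \<in> P" "i \<in> class_of P i" using class_of_eqI[OF assms(1)] by auto
qed

lemma partition_on_eq_class_of_image:
  assumes "partition_on C P"
  shows "P = class_of P ` C"
proof (intro equalityI subsetI)
  fix A assume A: "A \<in> P"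
  then obtain i where "i \<in> A" using assms by (fastforce simp: partition_on_def)
  moreover have "i \<in> C" using A \<open>i \<in> A\<close> assms by (auto simp: partition_on_def)
  ultimately show "A \<in> class_of P ` C" using class_of_eqI[OF assms A] by blast
qed (use class_of_in[OF assms] in auto)

lemma class_of_eq_Collect:
  assumes "partition_on C P" "i \<in> C"
  shows "class_of P i = {j\<in>C. class_of P j = class_of P i}"
  using assms class_of_in[OF assms(1)] class_of_eqI[OF assms(1)]
  by (auto simp: partition_on_def)

definition kernel_partition :: "('a \<Rightarrow> 'b) \<Rightarrow> 'a set \<Rightarrow> 'a set set" where
  "kernel_partition f C = (\<lambda>i. {j\<in>C. f j = f i}) ` C"

lemma partition_on_kernel_partition: "partition_on C (kernel_partition f C)"
  by (rule partition_onI) (auto simp: kernel_partition_def disjnt_def)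

lemma class_of_kernel_partition:
  "i \<in> C \<Longrightarrow> class_of (kernel_partition f C) i = {j\<in>C. f j = f i}"
  by (rule class_of_eqI[OF partition_on_kernel_partition]) (auto simp: kernel_partition_def)

lemma class_of_kernel_partition_eq_iff:
  assumes "i \<in> C" "j \<in> C"
  shows "class_of (kernel_partition f C) i = class_of (kernel_partition f C) j \<longleftrightarrow> f i = f j"
proof
  assume "class_of (kernel_partition f C) i = class_of (kernel_partition f C) j"
  then have "i \<in> {k\<in>C. f k = f j}"
    using assms by (simp add: class_of_kernel_partition set_eq_iff) metis
  then show "f i = f j" by simp
qed (use assms in \<open>simp add: class_of_kernel_partition\<close>)

text \<open>The criterion for surjectivity: a map that separates exactly the classes of
  \<open>P\<close> recovers \<open>P\<close>.\<close>

lemma kernel_partition_eq: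
  assumes "partition_on C P"
    and "\<And>i j. i \<in> C \<Longrightarrow> j \<in> C \<Longrightarrow> f i = f j \<longleftrightarrow> class_of P i = class_of P j"
  shows "kernel_partition f C = P"
proof -
  have "{j\<in>C. f j = f i} = class_of P i" if "i \<in> C" for i
    by (subst class_of_eq_Collect[OF assms(1) that]) (use assms(2) that in blast)
  then have "kernel_partition f C = class_of P ` C"
    unfolding kernel_partition_def by (rule image_cong[OF refl])
  then show ?thesis using partition_on_eq_class_of_image[OF assms(1)] by simp
qed

subsection \<open>B-type partitions\<close>

text \<open>Oddness makes negation carry the class of \<open>i\<close> to that of
  \<open>- i\<close>. If these agree, then \<open>f i = - f i\<close>, so the class is the one of
  0.\<close>

lemma B_type_kernel_partition:
  assumes f: "f \<in> odd_retractions n"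
  shows "B_type_partition n (kernel_partition f {- int n..int n})"
proof -
  note F = odd_retractionsD[OF f]
  let ?C = "{- int n..int n}"
  let ?c = "\<lambda>i. {j\<in>?C. f j = f i}"
  have neg: "uminus ` ?c i = ?c (- i)" for i
  proof (intro equalityI subsetI)
    fix j assume "j \<in> ?c (- i)"
    then show "j \<in> uminus ` ?c i"
      by (intro image_eqI[of _ _ "- j"]) (auto simp: F)
  qed (auto simp: F)
  have "\<exists>!Q. Q \<in> kernel_partition f ?C \<and> Q = uminus ` Q"
  proof (rule ex1I[of _ "?c 0"])
    show "?c 0 \<in> kernel_partition f ?C \<and> ?c 0 = uminus ` ?c 0"
      by (simp only: neg) (auto simp: kernel_partition_def)
  next
    fix Q assume "Q \<in> kernel_partition f ?C \<and> Q = uminus ` Q"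
    then obtain i where i: "i \<in> ?C" "Q = ?c i" "Q = ?c (- i)"
      using neg by (auto simp: kernel_partition_def)
    then have "i \<in> ?c (- i)" by blast
    then have "f i = f 0" by (simp add: F)
    then show "Q = ?c 0" using i by simp
  qed
  moreover have "uminus ` Q \<in> kernel_partition f ?C" if "Q \<in> kernel_partition f ?C" for Q
    using that neg by (auto simp: kernel_partition_def)
  ultimately show ?thesis
    unfolding B_type_partition_def by (intro conjI ballI partition_on_kernel_partition)
qed

lemma bij_betw_B_type:
  "bij_betw (\<lambda>f. kernel_partition f {- int n..int n}) (odd_retractions n) {Q. B_type_partition n Q}"
  unfolding bij_betw_def
proof
  let ?C = "{- int n..int n}"
  show "inj_on (\<lambda>f. kernel_partition f ?C) (odd_retractions n)"
  proof (rule inj_onI)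
    fix f g assume f: "f \<in> odd_retractions n" and g: "g \<in> odd_retractions n"
      and eq: "kernel_partition f ?C = kernel_partition g ?C"
    have in_kernel: "f i = f j \<longleftrightarrow> g i = g j" if "i \<in> ?C" "j \<in> ?C" for i j
      using class_of_kernel_partition_eq_iff[OF that] eq by metis
    \<comment> \<open>Both maps vanish outside \<open>{- n..n}\<close> and at 0, so replacing outer
      indices by 0 extends the equality of kernels to all integers.\<close>
    define t where "t i = (if \<bar>i\<bar> > int n then 0 else i)" for i
    have t: "t i \<in> ?C" "f (t i) = f i" "g (t i) = g i" for i
      using odd_retractionsD(4,5)[OF f] odd_retractionsD(4,5)[OF g] by (auto simp: t_def)
    show "f = g"
      by (rule odd_retraction_eqI[OF f g]) (metis t in_kernel)
  qed
  show "(\<lambda>f. kernel_partition f ?C) ` odd_retractions n = {Q. B_type_partition n Q}"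
  proof (intro equalityI subsetI)
    fix Q assume "Q \<in> {Q. B_type_partition n Q}"
    then have part: "partition_on ?C Q" and neg: "\<And>A. A \<in> Q \<Longrightarrow> uminus ` A \<in> Q"
      and uniq: "\<And>A B. A \<in> Q \<Longrightarrow> A = uminus ` A \<Longrightarrow> B \<in> Q \<Longrightarrow> B = uminus ` B \<Longrightarrow> A = B"
      unfolding B_type_partition_def by blast+
    \<comment> \<open>The class map, with all outer indices put into the class of 0 as
      \<open>ex_odd_retraction\<close> demands.\<close>
    define h where "h i = class_of Q (if \<bar>i\<bar> > int n then 0 else i)" for i
    have cneg: "class_of Q (- i) = uminus ` class_of Q i" if "i \<in> ?C" for i
      using class_of_in[OF part that] by (intro class_of_eqI[OF part] neg) auto
    have hneg: "h (- i) = uminus ` h i" for i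
    proof (cases "\<bar>i\<bar> > int n")
      case True
      then show ?thesis using cneg[of 0] by (simp add: h_def)
    next
      case False
      then have "i \<in> ?C" by auto
      from cneg[OF this] False show ?thesis by (simp add: h_def)
    qed
    have hQ: "h i \<in> Q" for i
      unfolding h_def by (rule class_of_in(1)[OF part]) auto
    have "\<exists>f\<in>odd_retractions n. \<forall>i j. f i = f j \<longleftrightarrow> h i = h j"
    proof (rule ex_odd_retraction)
      show "h (- i) = h (- j)" if "h i = h j" for i j using that hneg by simp
      \<comment> \<open>Both classes equal their own negatives, and a B-type partition has only one
        such class.\<close>
      show "h i = h 0" if "h (- i) = h i" for i
        using that hneg[of i] hneg[of 0] by (intro uniq[OF hQ _ hQ]) simp_all
      show "h i = h 0" if "\<bar>i\<bar> > int n" for i using that by (simp add: h_def)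
    qed
    then obtain f where f: "f \<in> odd_retractions n" and fh: "\<And>i j. f i = f j \<longleftrightarrow> h i = h j" by blast
    have "h i = class_of Q i" if "i \<in> ?C" for i using that by (auto simp: h_def)
    then have "kernel_partition f ?C = Q"
      by (intro kernel_partition_eq[OF part]) (simp only: fh)
    then show "Q \<in> (\<lambda>f. kernel_partition f ?C) ` odd_retractions n" using f by blast
  qed (use B_type_kernel_partition in auto)
qed

subsection \<open>Tagged partitions and polydiagonal subspaces\<close>

text \<open>For odd \<open>f\<close>, a signed class meets the positive indices in \<open>A\<close>
  and its negative meets them in \<open>opp A\<close>. A class is untagged when its signed class has
  no negative index from \<open>-n\<close> to \<open>-1\<close>; the zero class is tagged with
  itself.\<close>

definition tagged_kernel :: "nat \<Rightarrow> (int \<Rightarrow> int) \<Rightarrow> nat set set \<times> (nat set \<rightharpoonup> nat set)" where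
  "tagged_kernel n f =
    (let P = kernel_partition (\<lambda>i. f (int i)) {1..n};
         opp = (\<lambda>A. {j\<in>{1..n}. \<exists>i\<in>A. f (int i) = - f (int j)})
     in (P, \<lambda>A. if A \<in> P \<and> opp A \<noteq> {} then Some (opp A) else None))"

lemma partition_on_tagged_kernel: "partition_on {1..n} (fst (tagged_kernel n f))"
  by (simp add: tagged_kernel_def Let_def partition_on_kernel_partition)

lemma class_of_tagged_kernel:
  "i \<in> {1..n} \<Longrightarrow> class_of (fst (tagged_kernel n f)) i = {j\<in>{1..n}. f (int j) = f (int i)}"
  by (simp add: tagged_kernel_def Let_def class_of_kernel_partition)

lemma class_of_tagged_kernel_eq_iff:
  "i \<in> {1..n} \<Longrightarrow> j \<in> {1..n} \<Longrightarrow>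
    class_of (fst (tagged_kernel n f)) i = class_of (fst (tagged_kernel n f)) j
      \<longleftrightarrow> f (int i) = f (int j)"
  by (simp add: tagged_kernel_def Let_def class_of_kernel_partition_eq_iff)

lemma dom_tagged_kernel: "dom (snd (tagged_kernel n f)) \<subseteq> fst (tagged_kernel n f)"
  by (auto simp: tagged_kernel_def Let_def split: if_splits)

lemma tagged_kernel_Some_imp:
  assumes "snd (tagged_kernel n f) A = Some B"
  shows "\<exists>i\<in>{1..n}. \<exists>j\<in>{1..n}. A = class_of (fst (tagged_kernel n f)) i \<and>
    B = class_of (fst (tagged_kernel n f)) j \<and> f (int i) = - f (int j)"
proof -
  have A: "A \<in> kernel_partition (\<lambda>i. f (int i)) {1..n}"
    and B: "B = {j\<in>{1..n}. \<exists>i\<in>A. f (int i) = - f (int j)}" "B \<noteq> {}"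
    using assms by (auto simp: tagged_kernel_def Let_def split: if_splits)
  from A obtain k where k: "k \<in> {1..n}" "A = {j\<in>{1..n}. f (int j) = f (int k)}"
    by (auto simp: kernel_partition_def)
  from B obtain i j where ij: "j \<in> {1..n}" "i \<in> A" "f (int i) = - f (int j)" by blast
  have "i \<in> {1..n}" "A = {l\<in>{1..n}. f (int l) = f (int i)}" using k ij by auto
  moreover have "B = {l\<in>{1..n}. f (int l) = f (int j)}"
    unfolding B(1) using calculation(2) ij by auto
  ultimately show ?thesis using ij class_of_tagged_kernel by blast
qed

lemma tagged_kernel_Some_iff:
  assumes "i \<in> {1..n}" "j \<in> {1..n}"
  shows "snd (tagged_kernel n f) (class_of (fst (tagged_kernel n f)) i) =
      Some (class_of (fst (tagged_kernel n f)) j) \<longleftrightarrow> f (int i) = - f (int j)"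
    (is "?l \<longleftrightarrow> ?r")
proof
  assume ?l
  from tagged_kernel_Some_imp[OF this] obtain i' j' where
    "i' \<in> {1..n}" "j' \<in> {1..n}" "f (int i') = - f (int j')"
    "class_of (fst (tagged_kernel n f)) i = class_of (fst (tagged_kernel n f)) i'"
    "class_of (fst (tagged_kernel n f)) j = class_of (fst (tagged_kernel n f)) j'" by blast
  then show ?r using assms by (metis class_of_tagged_kernel_eq_iff)
next
  assume r: ?r
  let ?c = "\<lambda>i. {k\<in>{1..n}. f (int k) = f (int i)}"
  have "?c i \<in> kernel_partition (\<lambda>i. f (int i)) {1..n}"
    using assms by (auto simp: kernel_partition_def)
  moreover have "{l\<in>{1..n}. \<exists>k\<in>?c i. f (int k) = - f (int l)} = ?c j"
    using assms r by auto
  moreover have "?c j \<noteq> {}" using assms by auto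
  ultimately have "snd (tagged_kernel n f) (?c i) = Some (?c j)"
    by (simp only: tagged_kernel_def Let_def snd_conv simp_thms if_True)
  then show ?l using assms by (simp only: class_of_tagged_kernel)
qed

text \<open>The relation \<open>f i = - f j\<close> is symmetric, which gives the involution. On a
  class tagged with itself \<open>f\<close> equals its own negative, so this class is the zero set
  of \<open>f\<close>.\<close>

lemma tagged_partition_on_tagged_kernel: "tagged_partition_on {1..n} (tagged_kernel n f)"
proof -
  obtain P s where T: "tagged_kernel n f = (P, s)" by fastforce
  have "s B = Some A" if "s A = Some B" for A B
  proof -
    have "snd (tagged_kernel n f) A = Some B" using that T by simp
    from tagged_kernel_Some_imp[OF this] obtain i j where ij: "i \<in> {1..n}" "j \<in> {1..n}"
      "A = class_of P i" "B = class_of P j" "f (int i) = - f (int j)"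
      by (auto simp: T)
    then show ?thesis using tagged_kernel_Some_iff[OF ij(2,1), of f] T by simp
  qed
  moreover have "A = {j\<in>{1..n}. f (int j) = 0}" if "s A = Some A" for A
  proof -
    have "snd (tagged_kernel n f) A = Some A" using that T by simp
    from tagged_kernel_Some_imp[OF this] obtain i j where ij: "i \<in> {1..n}" "j \<in> {1..n}"
      "A = class_of (fst (tagged_kernel n f)) i" "A = class_of (fst (tagged_kernel n f)) j"
      "f (int i) = - f (int j)" by blast
    then have A: "A = {k\<in>{1..n}. f (int k) = f (int i)}" "A = {k\<in>{1..n}. f (int k) = f (int j)}"
      by (simp_all only: class_of_tagged_kernel)
    then have "f (int i) = f (int j)" using ij(1) by blast
    then show ?thesis using A ij(5) by auto
  qed
  moreover have "partition_on {1..n} P" "dom s \<subseteq> P"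
    using partition_on_tagged_kernel[of n f] dom_tagged_kernel[of n f] T by simp_all
  ultimately show ?thesis
    unfolding T tagged_partition_on_def partial_involution_on_def case_prod_conv by blast
qed

lemma tagged_kernel_eqI:
  assumes T: "tagged_partition_on {1..n} (P, s)"
    and same: "\<And>i j. i \<in> {1..n} \<Longrightarrow> j \<in> {1..n} \<Longrightarrow>
      f (int i) = f (int j) \<longleftrightarrow> class_of P i = class_of P j"
    and opp: "\<And>i j. i \<in> {1..n} \<Longrightarrow> j \<in> {1..n} \<Longrightarrow>
      f (int i) = - f (int j) \<longleftrightarrow> s (class_of P i) = Some (class_of P j)"
  shows "tagged_kernel n f = (P, s)"
proof -
  have part: "partition_on {1..n} P" and dom: "dom s \<subseteq> P"
    and inv: "\<And>A B. s A = Some B \<Longrightarrow> s B = Some A"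
    using T unfolding tagged_partition_on_def partial_involution_on_def case_prod_conv by blast+
  have fst: "fst (tagged_kernel n f) = P"
    using kernel_partition_eq[OF part, of "\<lambda>i. f (int i)"] same
    by (simp add: tagged_kernel_def Let_def)
  have "snd (tagged_kernel n f) A = Some B \<longleftrightarrow> s A = Some B" for A B
  proof
    assume "snd (tagged_kernel n f) A = Some B"
    from tagged_kernel_Some_imp[OF this] show "s A = Some B"
      unfolding fst using opp by blast
  next
    \<comment> \<open>Being an involution, \<open>s\<close> has \<open>B\<close> in its domain too,
      so both classes have representatives.\<close>
    assume s: "s A = Some B"
    then have "A \<in> class_of P ` {1..n}" "B \<in> class_of P ` {1..n}"
      using dom inv[OF s] partition_on_eq_class_of_image[OF part] by blast+
    then obtain i j where "i \<in> {1..n}" "j \<in> {1..n}" "A = class_of P i" "B = class_of P j" by blast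
    then show "snd (tagged_kernel n f) A = Some B"
      using tagged_kernel_Some_iff[of i n j f] fst opp s by simp
  qed
  then have "snd (tagged_kernel n f) = s" by (metis ext option.exhaust)
  then show ?thesis using fst by (metis prod.collapse)
qed

lemma ex_tagged_kernel:
  assumes T: "tagged_partition_on {1..n} (P, s)"
  shows "\<exists>f\<in>odd_retractions n. tagged_kernel n f = (P, s)"
proof -
  have part: "partition_on {1..n} P" and inv: "\<And>A B. s A = Some B \<Longrightarrow> s B = Some A"
    and fix1: "\<And>A B. s A = Some A \<Longrightarrow> s B = Some B \<Longrightarrow> A = B"
    using T unfolding tagged_partition_on_def partial_involution_on_def case_prod_conv by blast+
  let ?c = "\<lambda>i. class_of P (nat \<bar>i\<bar>)"
  let ?N = "\<lambda>i. i = 0 \<or> \<bar>i\<bar> > int n \<or> s (?c i) = Some (?c i)"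
  \<comment> \<open>A positive index gets the pair of its class and the partner of that class, a
    negative index the swapped pair. \<open>(None, None)\<close> is the only swap-invariant value
    and marks the indices that must map to 0.\<close>
  define h where "h i = (if ?N i then (None, None)
     else if i > 0 then (Some (?c i), s (?c i)) else (s (?c i), Some (?c i)))" for i
  have hneg: "h (- i) = prod.swap (h i)" for i by (auto simp: h_def)
  have h0: "h 0 = (None, None)" by (simp add: h_def)
  have "\<exists>f\<in>odd_retractions n. \<forall>i j. f i = f j \<longleftrightarrow> h i = h j"
  proof (rule ex_odd_retraction)
    show "h (- i) = h (- j)" if "h i = h j" for i j using that hneg by simp
    show "h i = h 0" if "h (- i) = h i" for i
      using that unfolding hneg h0 by (auto simp: h_def split: if_splits)
    show "h i = h 0" if "\<bar>i\<bar> > int n" for i using that by (simp add: h_def)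
  qed
  then obtain f where f: "f \<in> odd_retractions n" and fh: "\<And>i j. f i = f j \<longleftrightarrow> h i = h j" by blast
  have "tagged_kernel n f = (P, s)"
  proof (rule tagged_kernel_eqI[OF T])
    fix i j assume "i \<in> {1..n}" "j \<in> {1..n}"
    then have pos: "i > 0" "j > 0" "i \<le> n" "j \<le> n" by auto
    let ?A = "class_of P i" and ?B = "class_of P j"
    have hi: "h (int i) = (if s ?A = Some ?A then (None, None) else (Some ?A, s ?A))"
      and hj: "h (int j) = (if s ?B = Some ?B then (None, None) else (Some ?B, s ?B))"
      using pos by (simp_all add: h_def)
    have sym: "s ?A = Some ?B \<longleftrightarrow> s ?B = Some ?A" using inv by blast
    \<comment> \<open>Only self-tagged classes collapse to \<open>(None, None)\<close>; as there is
      at most one, no two classes are merged.\<close>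
    show "f (int i) = f (int j) \<longleftrightarrow> ?A = ?B"
      unfolding fh hi hj using fix1[of ?A ?B] by auto
    have "f (int i) = - f (int j) \<longleftrightarrow> h (int i) = h (- int j)"
      using fh odd_retractionsD(1)[OF f] by metis
    also have "\<dots> \<longleftrightarrow> s ?A = Some ?B"
      unfolding hneg hi hj using fix1[of ?A ?B] sym by (auto split: if_splits)
    finally show "f (int i) = - f (int j) \<longleftrightarrow> s (class_of P i) = Some (class_of P j)" .
  qed
  then show ?thesis using f by blast
qed

section \<open>Separating and counting polydiagonal subspaces\<close>

lemma polydiagonal_tagged_kernel:
  "polydiagonal n (tagged_kernel n f) = {x \<in> {1..n} \<rightarrow>\<^sub>E UNIV. \<forall>i\<in>{1..n}. \<forall>j\<in>{1..n}.
     (f (int i) = f (int j) \<longrightarrow> x i = x j) \<and> (f (int i) = - f (int j) \<longrightarrow> x i = - x j)}"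
  unfolding polydiagonal_def case_prod_unfold
  by (intro Collect_cong conj_cong ball_cong refl)
    (simp_all only: tagged_kernel_Some_iff class_of_tagged_kernel_eq_iff)

text \<open>The vector with entries \<open>f i\<close> is a generic point of the polydiagonal subspace belonging to
  \<open>f\<close>: it satisfies no other equation \<open>x\<^sub>i = \<plusminus> x\<^sub>j\<close> than those which define this subspace.\<close>

lemma inj_on_polydiagonal_tagged_kernel:
  "inj_on (\<lambda>f. polydiagonal n (tagged_kernel n f)) (odd_retractions n)"
proof -
  \<comment> \<open>Inclusion of the subspaces is turned into inclusion of the kernels, by way of
    \<open>f (g i) = f i\<close>.\<close>
  have kernel: "f i = f j"
    if f: "f \<in> odd_retractions n" and g: "g \<in> odd_retractions n"
      and sub: "polydiagonal n (tagged_kernel n f) \<subseteq> polydiagonal n (tagged_kernel n g)"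
      and eq: "g i = g j" for f g i j
  proof -
    note F = odd_retractionsD[OF f] and G = odd_retractionsD[OF g]
    let ?x = "restrict (\<lambda>i. real_of_int (f (int i))) {1..n}"
    have "?x \<in> polydiagonal n (tagged_kernel n f)"
      unfolding polydiagonal_tagged_kernel by auto
    with sub have x: "?x \<in> polydiagonal n (tagged_kernel n g)" by blast
    have pos: "(g (int k) = g (int l) \<longrightarrow> f (int k) = f (int l)) \<and>
        (g (int k) = - g (int l) \<longrightarrow> f (int k) = - f (int l))"
      if "k \<in> {1..n}" "l \<in> {1..n}" for k l
      using x that unfolding polydiagonal_tagged_kernel by fastforce
    \<comment> \<open>Up to sign, \<open>g k\<close> is 0 or an index in \<open>{1..n}\<close> with
      the same value under \<open>g\<close>. If it is 0, then \<open>g k = - g k\<close> forces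
      \<open>f k = 0\<close>; otherwise \<open>pos\<close> compares that index with
      \<open>k\<close>.\<close>
    have fg_pos: "f (g (int k)) = f (int k)" if k: "k \<in> {1..n}" for k
    proof -
      have le: "\<bar>g (int k)\<bar> \<le> int n" by (rule odd_retraction_abs_le[OF g])
      consider "g (int k) = 0" | "g (int k) > 0" | "g (int k) < 0" by linarith
      then show ?thesis
      proof cases
        case 1
        then have "f (int k) = - f (int k)" using pos[OF k k] by simp
        then show ?thesis using 1 F(5) by simp
      next
        case 2
        then have "nat (g (int k)) \<in> {1..n}" using le by auto
        from pos[OF this k] 2 show ?thesis by (simp add: G)
      next
        case 3
        then have "nat (- g (int k)) \<in> {1..n}" using le by auto
        from pos[OF this k] 3 show ?thesis by (simp add: F G)
      qed
    qed
    have fg: "f (g i) = f i" for i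
    proof -
      consider "i = 0" | "\<bar>i\<bar> > int n" | k where "k \<in> {1..n}" "i = int k"
        | k where "k \<in> {1..n}" "i = - int k"
      proof -
        have "nat \<bar>i\<bar> \<in> {1..n}" if "i \<noteq> 0" "\<bar>i\<bar> \<le> int n" using that by auto
        moreover have "i = int (nat \<bar>i\<bar>) \<or> i = - int (nat \<bar>i\<bar>)" by auto
        ultimately show ?thesis using that by (meson not_less)
      qed
      then show ?thesis
      proof cases
        case 2
        then show ?thesis using F(4,5) G(4) by simp
      qed (simp_all add: F G fg_pos)
    qed
    show ?thesis using fg[of i] fg[of j] eq by simp
  qed
  show ?thesis
    by (rule inj_onI, rule odd_retraction_eqI; (assumption | blast intro: kernel equalityD1 equalityD2))
qed

text \<open>Injectivity is inherited from the composite with \<open>polydiagonal n\<close>.\<close>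

lemma bij_betw_tagged_kernel:
  "bij_betw (tagged_kernel n) (odd_retractions n) {T. tagged_partition_on {1..n} T}"
proof -
  have "inj_on (tagged_kernel n) (odd_retractions n)"
    using inj_on_polydiagonal_tagged_kernel[of n] unfolding inj_on_def by metis
  moreover have "tagged_kernel n ` odd_retractions n = {T. tagged_partition_on {1..n} T}"
  proof (intro equalityI subsetI)
    fix T :: "nat set set \<times> (nat set \<rightharpoonup> nat set)"
    assume "T \<in> {T. tagged_partition_on {1..n} T}"
    then show "T \<in> tagged_kernel n ` odd_retractions n"
      using ex_tagged_kernel[of n "fst T" "snd T"] by force
  qed (use tagged_partition_on_tagged_kernel in blast)
  ultimately show ?thesis by (simp add: bij_betw_def)
qed

theorem proposition7p5:
  fixes n :: nat
  shows "(\<exists>f. bij_betw f {T :: nat set set \<times> (nat set \<rightharpoonup> nat set). tagged_partition_on {1..n} T}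
                        {\<Q>. B_type_partition n \<Q>}) \<and>
         real (card {V. is_polydiagonal_subspace n V}) = dowling n"
proof
  show "\<exists>f. bij_betw f {T :: nat set set \<times> (nat set \<rightharpoonup> nat set). tagged_partition_on {1..n} T}
                        {\<Q>. B_type_partition n \<Q>}"
    using bij_betw_trans[OF bij_betw_inv_into[OF bij_betw_tagged_kernel] bij_betw_B_type] by blast
  have "{V. is_polydiagonal_subspace n V} = polydiagonal n ` {T. tagged_partition_on {1..n} T}"
    by (auto simp: is_polydiagonal_subspace_def)
  \<comment> \<open>Parametrised by odd retractions, the subspaces form the image of an injective
    map, so they are counted by \<open>card_odd_retractions\<close>.\<close>
  also have "\<dots> = (\<lambda>f. polydiagonal n (tagged_kernel n f)) ` odd_retractions n"
    unfolding bij_betw_imp_surj_on[OF bij_betw_tagged_kernel, symmetric] image_image ..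
  finally show "real (card {V. is_polydiagonal_subspace n V}) = dowling n"
    by (simp add: card_image[OF inj_on_polydiagonal_tagged_kernel] card_odd_retractions)
qed

end
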